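(* If $\mathfrak b=\mathfrak s=\mathfrak c$, then every first countable regular space of cardinality $<\mathfrak c$ can be embedded, as a dense subspace, into a first countable countably compact regular space.
   Context: All topological spaces are assumed to be Hausdorff; "regular" includes $T_1$. A space is countably compact if every countably infinite subset has an accumulation point. $\mathfrak c=2^{\omega}$ is the continuum; $\mathfrak b$ is the bounding number (least size of a family in ${}^{\omega}\omega$ not bounded under eventual domination $\le^*$); $\mathfrak s$ is the splitting number (least size of a family $\mathcal S$ of subsets of $\omega$ such that for every infinite $D\subset\omega$ there is $S\in\mathcal S$ with both $D\cap S$ and $D\setminus S$ infinite). *)

theory Defs
  imports "HOL-Analysis.Analysis"
begin

unbundle cardinal_syntax

text \<open>
  The least cardinality of a member of a collection of sets. Cardinals are compared by \<open>\<le>o\<close>, \<open><o\<close>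
  and \<open>=o\<close>, so the choice of a member of least size is immaterial.
\<close>

definition least_size :: "'a set set \<Rightarrow> 'a rel" where
  "least_size \<C> = |SOME F. F \<in> \<C> \<and> (\<forall>G\<in>\<C>. |F| \<le>o |G| )|"

lemma least_size:
  assumes "\<C> \<noteq> {}"
  shows "\<exists>F\<in>\<C>. least_size \<C> = |F|" and "\<And>G. G \<in> \<C> \<Longrightarrow> least_size \<C> \<le>o |G|"
proof -
  have "\<exists>r\<in>card_of ` \<C>. \<forall>r'\<in>card_of ` \<C>. r \<le>o r'"
    by (rule exists_minim_Card_order) (use assms card_of_Card_order in auto)
  then have "\<exists>F. F \<in> \<C> \<and> (\<forall>G\<in>\<C>. |F| \<le>o |G| )"
    by blast
  from someI_ex[OF this]
  show "\<exists>F\<in>\<C>. least_size \<C> = |F|" and "\<And>G. G \<in> \<C> \<Longrightarrow> least_size \<C> \<le>o |G|"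
    unfolding least_size_def by blast+
qed

definition continuum :: "(nat \<Rightarrow> bool) rel" where
  "continuum = ctwo ^c natLeq"

definition eventually_dominated :: "(nat \<Rightarrow> nat) \<Rightarrow> (nat \<Rightarrow> nat) \<Rightarrow> bool"  (infix \<open>\<le>*\<close> 50) where
  "f \<le>* g \<longleftrightarrow> (\<forall>\<^sub>F n in sequentially. f n \<le> g n)"

definition unbounded_family :: "(nat \<Rightarrow> nat) set \<Rightarrow> bool" where
  "unbounded_family F \<longleftrightarrow> \<not> (\<exists>g. \<forall>f\<in>F. f \<le>* g)"

definition bounding_number :: "(nat \<Rightarrow> nat) rel" where
  "bounding_number = least_size {F. unbounded_family F}"

definition splitting_family :: "nat set set \<Rightarrow> bool" where
  "splitting_family \<S> \<longleftrightarrow> (\<forall>D. infinite D \<longrightarrow> (\<exists>S\<in>\<S>. infinite (D \<inter> S) \<and> infinite (D - S)))"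

definition splitting_number :: "nat set rel" where
  "splitting_number = least_size {\<S>. splitting_family \<S>}"

lemma unbounded_family_UNIV: "unbounded_family UNIV"
proof -
  have "\<not> (\<lambda>n. Suc (g n)) \<le>* g" for g
    by (simp add: eventually_dominated_def)
  then show ?thesis
    unfolding unbounded_family_def by blast
qed

lemma splitting_family_UNIV: "splitting_family UNIV"
  unfolding splitting_family_def
proof (intro allI impI)
  fix D :: "nat set"
  assume "infinite D"
  then obtain A B where "A \<subseteq> D" "B \<subseteq> D" "infinite A" "infinite B" "A \<inter> B = {}"
    by (rule infinite_split)
  moreover have "B \<subseteq> D - A"
    using calculation by blast
  ultimately have "infinite (D \<inter> A)" "infinite (D - A)"
    by (auto simp: Int_absorb1 dest: finite_subset)
  then show "\<exists>S\<in>UNIV. infinite (D \<inter> S) \<and> infinite (D - S)"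
    by blast
qed

text \<open>
  The library predicate \<^const>\<open>countably_compact\<close> concerns subsets of a type of class
  \<^class>\<open>topological_space\<close> and is stated with open covers; the following one is for abstract
  topologies and uses accumulation points.
\<close>

definition countably_compact_space :: "'a topology \<Rightarrow> bool" where
  "countably_compact_space X \<longleftrightarrow>
    (\<forall>A. A \<subseteq> topspace X \<and> countable A \<and> infinite A \<longrightarrow> X derived_set_of A \<noteq> {})"

text \<open>
  \<^const>\<open>regular_space\<close> does not include the \<open>T\<^sub>1\<close> axiom. Both together imply \<^const>\<open>Hausdorff_space\<close>.
\<close>

definition regular_T1_space :: "'a topology \<Rightarrow> bool" where
  "regular_T1_space X \<longleftrightarrow> regular_space X \<and> t1_space X"

lemma regular_T1_imp_Hausdorff_space: "regular_T1_space X \<Longrightarrow> Hausdorff_space X"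
  by (simp add: regular_T1_space_def regular_t1_imp_Hausdorff_space)

text \<open>
  A first countable Hausdorff space with a dense subset of at most continuum many points has itself at
  most continuum many points, because each point is the limit of a sequence from the dense subset.
  So quantifying over topologies \<open>Y\<close> on subsets of a type with continuum many elements, such as
  \<open>nat set\<close>, covers up to homeomorphism all first countable Hausdorff spaces into which a space of
  cardinality less than the continuum embeds densely.
\<close>

definition dense_embedding :: "'a topology \<Rightarrow> 'b topology \<Rightarrow> ('a \<Rightarrow> 'b) \<Rightarrow> bool" where
  "dense_embedding X Y e \<longleftrightarrow>
    embedding_map X Y e \<and> Y closure_of (e ` topspace X) = topspace Y"

end

theory Submission
  imports Defs
begin

text \<open>
  A first countable regular \<open>T\<^sub>1\<close> space is presented by countable decreasing neighbourhood bases
  \<open>B x n\<close> such that the closure of \<open>B x (n + 1)\<close> lies in \<open>B x n\<close> (locale \<open>nbhd_system\<close>). The space is made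
  countably compact by adjoining limit points to closed discrete sequences, one at a time, along a
  well-order of type \<open>c\<close>; every stage has fewer than \<open>c\<close> points and so fewer than \<open>c\<close> basic
  neighbourhoods. Here \<open>c\<close> is the continuum, and \<open>b\<close> and \<open>s\<close> are the bounding and the splitting number.

  If the neighbourhoods of the old points stayed as they are when a point \<open>p\<close> is adjoined, then
  regularity could be lost at limit stages, since the closure of a neighbourhood could gain new points
  at every step. Instead the old neighbourhoods grow: \<open>p\<close> enters \<open>B x n\<close> if the sequence \<open>d\<close> that is
  to converge to \<open>p\<close> is eventually in \<open>B x n\<close>. This gives a consistent answer because
  \<open>d\<close> can be thinned out so that no basic neighbourhood splits it, which is what \<open>s = c\<close> provides.
  The neighbourhoods of \<open>p\<close> are unions of small neighbourhoods of the \<open>d k\<close>. They have to be so small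
  that, for each \<open>B x n\<close>, almost all of them lie in \<open>B x n\<close> or almost all of them miss \<open>B x (n + 1)\<close>;
  for a single \<open>B x n\<close> this asks that the indices of these neighbourhoods grow at some rate, and all
  these rates are eventually dominated by a single one because \<open>b = c\<close>. The result is
  \<open>adjoin_limit_point\<close>.

  The step preserves inclusion and disjointness of old basic neighbourhoods and keeps the old points
  dense (\<open>dense_extension\<close>). Hence all properties of a neighbourhood system, regularity included,
  pass to unions of chains (\<open>nbhd_system_chain_union\<close>). Since \<open>c\<close> is not a countable union of sets of
  smaller size, a countable set of points of the final space already lies in some stage, and
  bookkeeping arranges that one of the later steps takes care of it
  (\<open>countably_compact_dense_extension\<close>).
\<close>

section \<open>Families smaller than the continuum\<close>

abbreviation small :: "'a set \<Rightarrow> bool" where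
  "small A \<equiv> |A| <o |UNIV :: nat set set|"

lemma card_nat_sets_continuum: "|UNIV :: nat set set| =o continuum"
proof -
  have "|Pow (UNIV :: nat set)| =o |Func (UNIV :: nat set) (UNIV :: bool set)|"
    by (rule card_of_Pow_Func)
  then show ?thesis
    by (simp add: continuum_def cexp_def ctwo_def Field_natLeq Field_card_of)
qed

lemma small_image: "small A \<Longrightarrow> small (f ` A)"
  by (rule ordLeq_ordLess_trans[OF card_of_image])

lemma small_subset: "small B \<Longrightarrow> A \<subseteq> B \<Longrightarrow> small A"
  by (rule ordLeq_ordLess_trans[OF card_of_mono1])

lemma infinite_nat_sets: "infinite (UNIV :: nat set set)"
  by (simp add: Finite_Set.finite_set)

lemma small_Un: "small A \<Longrightarrow> small B \<Longrightarrow> small (A \<union> B)"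
  by (rule card_of_Un_ordLess_infinite[OF infinite_nat_sets])

lemma small_nat: "small (UNIV :: nat set)"
  using card_of_Pow[of "UNIV :: nat set"] by simp

lemma small_Times_nat:
  assumes "small A"
  shows "small (A \<times> (UNIV :: nat set))"
proof (cases "finite A")
  case True
  then have "|A| \<le>o |UNIV :: nat set|"
    by (simp add: finite_iff_ordLess_natLeq ordLess_imp_ordLeq ordLess_ordIso_trans
        ordIso_symmetric[OF card_of_nat])
  then have "|A \<times> (UNIV :: nat set)| \<le>o |UNIV :: nat set|"
    using card_of_Sigma_ordLeq_infinite[OF infinite_UNIV_nat, of A "\<lambda>_. UNIV"] card_of_refl
      ordIso_imp_ordLeq by blast
  then show ?thesis
    using small_nat by (rule ordLeq_ordLess_trans)
next
  case False
  then have "|A \<times> (UNIV :: nat set)| =o |A|"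
    using card_of_Times_infinite[OF False, of "UNIV :: nat set"] infinite_iff_card_of_nat by auto
  then show ?thesis
    using assms by (rule ordIso_ordLess_trans)
qed

lemma small_family_dominated:
  assumes "bounding_number =o continuum" and "small F"
  shows "\<exists>g. \<forall>f\<in>F. f \<le>* g"
proof (rule ccontr)
  assume "\<not> ?thesis"
  then have "F \<in> {F. unbounded_family F}"
    by (simp add: unbounded_family_def)
  then have "bounding_number \<le>o |F|"
    unfolding bounding_number_def by (rule least_size(2)[rotated]) (use unbounded_family_UNIV in auto)
  moreover have "|F| <o bounding_number"
    using assms(2) ordIso_transitive[OF card_nat_sets_continuum ordIso_symmetric[OF assms(1)]]
    by (rule ordLess_ordIso_trans)
  ultimately show False
    by (simp add: not_ordLess_ordLeq)
qed

lemma small_family_not_splitting: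
  assumes "splitting_number =o continuum" and "small \<S>"
  shows "\<exists>D :: nat set. infinite D \<and> (\<forall>S\<in>\<S>. finite (D \<inter> S) \<or> finite (D - S))"
proof (rule ccontr)
  assume "\<not> ?thesis"
  then have "\<S> \<in> {\<S>. splitting_family \<S>}"
    by (auto simp: splitting_family_def)
  then have "splitting_number \<le>o |\<S>|"
    unfolding splitting_number_def by (rule least_size(2)[rotated]) (use splitting_family_UNIV in auto)
  moreover have "|\<S>| <o splitting_number"
    using assms(2) ordIso_transitive[OF card_nat_sets_continuum ordIso_symmetric[OF assms(1)]]
    by (rule ordLess_ordIso_trans)
  ultimately show False
    by (simp add: not_ordLess_ordLeq)
qed

definition encode :: "(nat \<Rightarrow> nat set) \<Rightarrow> nat set" where
  "encode f = {prod_encode (n, m) |n m. m \<in> f n}"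

definition decode :: "nat set \<Rightarrow> nat \<Rightarrow> nat set" where
  "decode S n = {m. prod_encode (n, m) \<in> S}"

lemma decode_encode [simp]: "decode (encode f) = f"
  by (auto simp: decode_def encode_def)

text \<open>
  Koenig's diagonal argument: the coordinate \<open>n\<close> of the elements of \<open>A n\<close> does not take all values,
  and a set whose coordinates are values that are missed lies in none of the \<open>A n\<close>.
\<close>

lemma continuum_not_countable_union_of_small:
  fixes A :: "nat \<Rightarrow> nat set set"
  assumes "\<And>n. small (A n)"
  shows "(\<Union>n. A n) \<noteq> UNIV"
proof -
  have "\<exists>T. T \<notin> (\<lambda>S. decode S n) ` A n" for n
  proof (rule ccontr)
    assume "\<not> ?thesis"
    then have "(\<lambda>S. decode S n) ` A n = UNIV"
      by blast
    then have "small (UNIV :: nat set set)"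
      using small_image[OF assms, of "\<lambda>S. decode S n" n] by simp
    then show False
      using ordLess_irreflexive by blast
  qed
  then obtain h where h: "\<And>n. h n \<notin> (\<lambda>S. decode S n) ` A n"
    by metis
  have "encode h \<notin> A n" for n
    using h[of n] by (metis decode_encode image_eqI)
  then show ?thesis
    by blast
qed

section \<open>Neighbourhood systems\<close>

definition points :: "('p \<Rightarrow> nat \<Rightarrow> 'p set) \<Rightarrow> 'p set" where
  "points B = {x. x \<in> B x 0}"

text \<open>
  The family \<open>B\<close> carries its own set of points, so that a growing space is a growing family of sets
  and the union of a chain of spaces can be formed pointwise. The axiom \<open>closure\<close> puts the closure of
  \<open>B x (Suc n)\<close> inside \<open>B x n\<close>; this is how regularity is recorded.
\<close>

locale nbhd_system =
  fixes B :: "'p \<Rightarrow> nat \<Rightarrow> 'p set"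
  assumes outside: "x \<notin> points B \<Longrightarrow> B x n = {}"
    and centre: "x \<in> points B \<Longrightarrow> x \<in> B x n"
    and within: "B x n \<subseteq> points B"
    and decreasing: "B x (Suc n) \<subseteq> B x n"
    and base: "y \<in> B x n \<Longrightarrow> \<exists>m. B y m \<subseteq> B x n"
    and closure: "y \<in> points B \<Longrightarrow> (\<And>m. B y m \<inter> B x (Suc n) \<noteq> {}) \<Longrightarrow> y \<in> B x n"
    and t1: "x \<in> points B \<Longrightarrow> x \<noteq> y \<Longrightarrow> \<exists>n. y \<notin> B x n"
begin

lemma antimono: "m \<le> n \<Longrightarrow> B x n \<subseteq> B x m"
  by (rule lift_Suc_antimono_le[of "B x"]) (rule decreasing)

definition nbhd_topology :: "'p topology" where
  "nbhd_topology = topology (\<lambda>U. U \<subseteq> points B \<and> (\<forall>x\<in>U. \<exists>n. B x n \<subseteq> U))"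

lemma openin_nbhd_topology:
  "openin nbhd_topology U \<longleftrightarrow> U \<subseteq> points B \<and> (\<forall>x\<in>U. \<exists>n. B x n \<subseteq> U)"
proof -
  have "istopology (\<lambda>U. U \<subseteq> points B \<and> (\<forall>x\<in>U. \<exists>n. B x n \<subseteq> U))"
    unfolding istopology_def
  proof (intro conjI allI impI)
    fix S T
    assume S: "S \<subseteq> points B \<and> (\<forall>x\<in>S. \<exists>n. B x n \<subseteq> S)"
      and T: "T \<subseteq> points B \<and> (\<forall>x\<in>T. \<exists>n. B x n \<subseteq> T)"
    show "S \<inter> T \<subseteq> points B"
      using S by (intro le_infI1) (rule conjunct1)
    show "\<forall>x\<in>S \<inter> T. \<exists>n. B x n \<subseteq> S \<inter> T"
    proof
      fix x
      assume x: "x \<in> S \<inter> T"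
      obtain m where m: "B x m \<subseteq> S"
        using S x by (elim IntE conjE) (drule (1) bspec, elim exE)
      obtain n where n: "B x n \<subseteq> T"
        using T x by (elim IntE conjE) (drule (1) bspec, elim exE)
      have "B x (max m n) \<subseteq> S \<inter> T"
        using m n antimono[of m "max m n" x] antimono[of n "max m n" x] by auto
      then show "\<exists>n. B x n \<subseteq> S \<inter> T" ..
    qed
  next
    fix \<K>
    assume *: "\<forall>S\<in>\<K>. S \<subseteq> points B \<and> (\<forall>x\<in>S. \<exists>n. B x n \<subseteq> S)"
    show "\<Union>\<K> \<subseteq> points B"
      by (rule Union_least) (simp add: *)
    show "\<forall>x\<in>\<Union>\<K>. \<exists>n. B x n \<subseteq> \<Union>\<K>"
    proof
      fix x
      assume "x \<in> \<Union>\<K>"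
      then obtain S where S: "S \<in> \<K>" "x \<in> S" ..
      then obtain n where "B x n \<subseteq> S"
        using * S by meson
      then have "B x n \<subseteq> \<Union>\<K>"
        using S(1) by (rule Sup_upper2[rotated])
      then show "\<exists>n. B x n \<subseteq> \<Union>\<K>" ..
    qed
  qed
  then show ?thesis
    by (simp add: nbhd_topology_def)
qed

lemma openin_nbhd: "openin nbhd_topology (B x n)"
  using within base by (simp add: openin_nbhd_topology)

lemma topspace_nbhd_topology: "topspace nbhd_topology = points B"
proof
  show "topspace nbhd_topology \<subseteq> points B"
    using iffD1[OF openin_nbhd_topology openin_topspace] by (rule conjunct1)
  show "points B \<subseteq> topspace nbhd_topology"
  proof
    fix x
    assume "x \<in> points B"
    then have "x \<in> B x 0"
      by (rule centre)
    then show "x \<in> topspace nbhd_topology"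
      using openin_subset[OF openin_nbhd] by blast
  qed
qed

lemma closure_of_nbhd: "nbhd_topology closure_of (B x (Suc n)) \<subseteq> B x n"
proof
  fix y
  assume y: "y \<in> nbhd_topology closure_of (B x (Suc n))"
  then have "y \<in> points B"
    by (simp add: in_closure_of topspace_nbhd_topology)
  moreover have "B y m \<inter> B x (Suc n) \<noteq> {}" for m
  proof -
    have "y \<in> B y m"
      using \<open>y \<in> points B\<close> by (rule centre)
    then show ?thesis
      using y openin_nbhd[of y m] unfolding in_closure_of by blast
  qed
  ultimately show "y \<in> B x n"
    using closure[of y x n] by blast
qed

lemma first_countable_nbhd_topology: "first_countable nbhd_topology"
  unfolding first_countable_def
proof
  fix x
  assume "x \<in> topspace nbhd_topology"
  then have "x \<in> B x n" for n
    by (simp add: centre topspace_nbhd_topology)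
  moreover have "\<exists>n. B x n \<subseteq> U" if "openin nbhd_topology U" "x \<in> U" for U
    using that by (simp add: openin_nbhd_topology)
  ultimately show "\<exists>\<B>. countable \<B> \<and> (\<forall>V\<in>\<B>. openin nbhd_topology V) \<and>
      (\<forall>U. openin nbhd_topology U \<and> x \<in> U \<longrightarrow> (\<exists>V\<in>\<B>. x \<in> V \<and> V \<subseteq> U))"
    by (intro exI[of _ "range (B x)"]) (simp add: openin_nbhd)
qed

lemma regular_T1_nbhd_topology: "regular_T1_space nbhd_topology"
proof -
  have "neighbourhood_base_of (closedin nbhd_topology) nbhd_topology"
    unfolding neighbourhood_base_of
  proof (intro allI impI)
    fix W x
    assume "openin nbhd_topology W \<and> x \<in> W"
    then obtain n where n: "B x n \<subseteq> W" and "x \<in> points B"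
      unfolding openin_nbhd_topology by blast
    show "\<exists>U V. openin nbhd_topology U \<and> closedin nbhd_topology V \<and> x \<in> U \<and> U \<subseteq> V \<and> V \<subseteq> W"
    proof (intro exI conjI)
      show "openin nbhd_topology (B x (Suc n))"
        by (rule openin_nbhd)
      show "x \<in> B x (Suc n)"
        using \<open>x \<in> points B\<close> by (rule centre)
      show "B x (Suc n) \<subseteq> nbhd_topology closure_of (B x (Suc n))"
        by (intro closure_of_subset openin_subset openin_nbhd)
      show "nbhd_topology closure_of (B x (Suc n)) \<subseteq> W"
        using closure_of_nbhd n by (rule subset_trans)
    qed (rule closedin_closure_of)
  qed
  moreover have "t1_space nbhd_topology"
    unfolding t1_space_def topspace_nbhd_topology
  proof (intro ballI impI)
    fix x y
    assume "x \<in> points B" "x \<noteq> y"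
    then obtain n where "y \<notin> B x n"
      using t1 by blast
    then show "\<exists>U. openin nbhd_topology U \<and> x \<in> U \<and> y \<notin> U"
      using openin_nbhd centre[OF \<open>x \<in> points B\<close>] by blast
  qed
  ultimately show ?thesis
    by (simp add: regular_T1_space_def neighbourhood_base_of_closedin)
qed

lemma derived_set_of_nbhd_topology:
  "nbhd_topology derived_set_of A = {x \<in> points B. \<forall>n. \<exists>y\<in>A. y \<noteq> x \<and> y \<in> B x n}"
proof -
  have "(\<forall>T. x \<in> T \<and> openin nbhd_topology T \<longrightarrow> (\<exists>y\<noteq>x. y \<in> A \<and> y \<in> T)) \<longleftrightarrow>
      (\<forall>n. \<exists>y\<in>A. y \<noteq> x \<and> y \<in> B x n)" (is "?L \<longleftrightarrow> ?R") if "x \<in> points B" for x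
  proof
    show ?R if ?L
    proof
      fix n
      show "\<exists>y\<in>A. y \<noteq> x \<and> y \<in> B x n"
        using \<open>?L\<close> centre[OF \<open>x \<in> points B\<close>, of n] openin_nbhd[of x n] by blast
    qed
    show ?L if ?R
    proof (intro allI impI)
      fix T
      assume "x \<in> T \<and> openin nbhd_topology T"
      then obtain n where "B x n \<subseteq> T"
        using openin_nbhd_topology by blast
      then show "\<exists>y\<noteq>x. y \<in> A \<and> y \<in> T"
        using \<open>?R\<close> by blast
    qed
  qed
  then show ?thesis
    by (auto simp: derived_set_of_def topspace_nbhd_topology)
qed

end

section \<open>Dense extensions\<close>

text \<open>
  The part with inclusions is what makes the property \<open>base\<close> pass to unions of chains, because the
  index \<open>m\<close> that works at one stage keeps working at later ones. The last part makes disjointness of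
  two basic neighbourhoods, and thereby the property \<open>closure\<close>, pass to unions of chains.
\<close>

definition dense_extension :: "('p \<Rightarrow> nat \<Rightarrow> 'p set) \<Rightarrow> ('p \<Rightarrow> nat \<Rightarrow> 'p set) \<Rightarrow> bool" where
  "dense_extension B B' \<longleftrightarrow>
    points B \<subseteq> points B' \<and>
    (\<forall>x\<in>points B. \<forall>n. B' x n \<inter> points B = B x n) \<and>
    (\<forall>x\<in>points B. \<forall>y\<in>points B. \<forall>m n. B y m \<subseteq> B x n \<longrightarrow> B' y m \<subseteq> B' x n) \<and>
    (\<forall>x\<in>points B'. \<forall>n. B' x n \<inter> points B \<noteq> {})"

lemma
  assumes "dense_extension B B'"
  shows dense_extension_points: "points B \<subseteq> points B'"
    and dense_extension_trace: "x \<in> points B \<Longrightarrow> B' x n \<inter> points B = B x n"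
    and dense_extension_subset:
      "x \<in> points B \<Longrightarrow> y \<in> points B \<Longrightarrow> B y m \<subseteq> B x n \<Longrightarrow> B' y m \<subseteq> B' x n"
    and dense_extension_meets: "x \<in> points B' \<Longrightarrow> B' x n \<inter> points B \<noteq> {}"
  using assms by (auto simp: dense_extension_def)

lemma dense_extension_refl:
  assumes "nbhd_system B"
  shows "dense_extension B B"
proof -
  have "x \<in> points B \<Longrightarrow> B x n \<inter> points B \<noteq> {}" for x n
    using nbhd_system.centre[OF assms, of x n] by blast
  moreover have "B x n \<inter> points B = B x n" for x n
    using nbhd_system.within[OF assms, of x n] by blast
  ultimately show ?thesis
    by (simp add: dense_extension_def)
qed

lemma dense_extension_trans:
  assumes "nbhd_system B''" and 1: "dense_extension B B'" and 2: "dense_extension B' B''"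
  shows "dense_extension B B''"
  unfolding dense_extension_def
proof (intro conjI ballI allI impI)
  note sub = dense_extension_points[OF 1]
  show "points B \<subseteq> points B''"
    using sub dense_extension_points[OF 2] by (rule subset_trans)
  show "B'' x n \<inter> points B = B x n" if "x \<in> points B" for x n
    using dense_extension_trace[OF 1 that, of n] dense_extension_trace[OF 2 subsetD[OF sub that], of n]
      sub by blast
  show "B'' y m \<subseteq> B'' x n" if "x \<in> points B" "y \<in> points B" "B y m \<subseteq> B x n" for x y m n
    by (intro dense_extension_subset[OF 2] dense_extension_subset[OF 1] subsetD[OF sub] that)
  fix x n
  assume "x \<in> points B''"
  then obtain y where y: "y \<in> B'' x n" "y \<in> points B'"
    using dense_extension_meets[OF 2] by blast
  then obtain m where "B'' y m \<subseteq> B'' x n"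
    using nbhd_system.base[OF assms(1)] by blast
  moreover have "B' y m \<subseteq> B'' y m"
    using dense_extension_trace[OF 2 y(2), of m] by blast
  ultimately show "B'' x n \<inter> points B \<noteq> {}"
    using dense_extension_meets[OF 1 y(2), of m] by blast
qed

lemma dense_extension_disjoint:
  assumes "nbhd_system B'" and B': "dense_extension B B'" and x: "x \<in> points B" and y: "y \<in> points B"
    and disj: "B x m \<inter> B y n = {}"
  shows "B' x m \<inter> B' y n = {}"
proof (rule ccontr)
  interpret nbhd_system B' by fact
  assume "B' x m \<inter> B' y n \<noteq> {}"
  then obtain z where z: "z \<in> B' x m" "z \<in> B' y n"
    by blast
  obtain i where i: "B' z i \<subseteq> B' x m"
    using base[OF z(1)] ..
  obtain j where j: "B' z j \<subseteq> B' y n"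
    using base[OF z(2)] ..
  have "B' z (max i j) \<subseteq> B' x m \<inter> B' y n"
    using i j antimono[of i "max i j" z] antimono[of j "max i j" z] by auto
  moreover have "B' z (max i j) \<inter> points B \<noteq> {}"
    by (rule dense_extension_meets[OF B' subsetD[OF within z(1)]])
  ultimately show False
    using disj dense_extension_trace[OF B' x, of m] dense_extension_trace[OF B' y, of n] by blast
qed

lemma derived_set_of_dense_extension:
  assumes "nbhd_system B" and "nbhd_system B'" and "dense_extension B B'"
    and "nbhd_system.nbhd_topology B derived_set_of A \<noteq> {}"
  shows "nbhd_system.nbhd_topology B' derived_set_of A \<noteq> {}"
proof -
  obtain x where x: "x \<in> points B" and lim: "\<And>n. \<exists>y\<in>A. y \<noteq> x \<and> y \<in> B x n"
    using assms(4) unfolding nbhd_system.derived_set_of_nbhd_topology[OF assms(1)] by auto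
  have "\<exists>y\<in>A. y \<noteq> x \<and> y \<in> B' x n" for n
    using lim[of n] dense_extension_trace[OF assms(3) x, of n] by blast
  then have "x \<in> nbhd_system.nbhd_topology B' derived_set_of A"
    using x dense_extension_points[OF assms(3)]
    unfolding nbhd_system.derived_set_of_nbhd_topology[OF assms(2)] by auto
  then show ?thesis
    by blast
qed

lemma subtopology_dense_extension:
  assumes "nbhd_system B" and "nbhd_system B'" and B': "dense_extension B B'"
  shows "subtopology (nbhd_system.nbhd_topology B') (points B) = nbhd_system.nbhd_topology B"
  unfolding topology_eq
proof (intro allI iffI)
  interpret B: nbhd_system B by fact
  interpret B': nbhd_system B' by fact
  fix U
  show "openin B.nbhd_topology U" if U: "openin (subtopology B'.nbhd_topology (points B)) U"
  proof -
    obtain V where V: "openin B'.nbhd_topology V" "U = V \<inter> points B"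
      using U unfolding openin_subtopology by blast
    have "\<exists>n. B x n \<subseteq> U" if x: "x \<in> U" for x
    proof -
      obtain n where "B' x n \<subseteq> V"
        using V x unfolding B'.openin_nbhd_topology by blast
      then have "B x n \<subseteq> U"
        using V(2) x dense_extension_trace[OF B', of x n] by blast
      then show ?thesis ..
    qed
    then show ?thesis
      using V(2) unfolding B.openin_nbhd_topology by blast
  qed
  show "openin (subtopology B'.nbhd_topology (points B)) U" if U: "openin B.nbhd_topology U"
  proof -
    define V where "V = (\<Union>(x, n)\<in>{(x, n). x \<in> U \<and> B x n \<subseteq> U}. B' x n)"
    have "openin B'.nbhd_topology V"
      unfolding V_def by (intro openin_Union) (auto intro: B'.openin_nbhd)
    moreover have "U = V \<inter> points B"
    proof
      show "U \<subseteq> V \<inter> points B"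
      proof
        fix x
        assume x: "x \<in> U"
        then obtain n where n: "B x n \<subseteq> U" and xB: "x \<in> points B"
          using U unfolding B.openin_nbhd_topology by blast
        have "x \<in> B' x n"
          using xB dense_extension_points[OF B'] B'.centre by blast
        then show "x \<in> V \<inter> points B"
          using x n xB unfolding V_def by blast
      qed
      show "V \<inter> points B \<subseteq> U"
      proof
        fix y
        assume "y \<in> V \<inter> points B"
        then obtain x n where "x \<in> U" "B x n \<subseteq> U" "y \<in> B' x n" "y \<in> points B"
          unfolding V_def by blast
        moreover have "x \<in> points B"
          using \<open>x \<in> U\<close> U unfolding B.openin_nbhd_topology by blast
        ultimately show "y \<in> U"
          using dense_extension_trace[OF B', of x n] by blast
      qed
    qed
    ultimately show ?thesis
      unfolding openin_subtopology by blast
  qed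
qed

lemma closure_of_dense_extension:
  assumes "nbhd_system B'" and B': "dense_extension B B'"
  shows "nbhd_system.nbhd_topology B' closure_of (points B) = points B'"
proof -
  interpret nbhd_system B' by fact
  have "\<exists>y\<in>points B. y \<in> T" if "x \<in> T" "openin nbhd_topology T" for x T
  proof -
    obtain n where "B' x n \<subseteq> T" "x \<in> points B'"
      using \<open>x \<in> T\<close> \<open>openin nbhd_topology T\<close> unfolding openin_nbhd_topology by blast
    then show ?thesis
      using dense_extension_meets[OF B', of x n] by blast
  qed
  then show ?thesis
    by (auto simp: closure_of_def topspace_nbhd_topology)
qed

section \<open>Adjoining a limit point to a sequence\<close>

text \<open>
  There are fewer sets of indices \<open>{k. d k \<in> B x n}\<close> than the splitting number, so some infinite set of
  indices is split by none of them.
\<close>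

lemma (in nbhd_system) unsplit_subsequence:
  fixes d :: "nat \<Rightarrow> 'p"
  assumes "splitting_number =o continuum" and "small (points B)"
  shows "\<exists>r. strict_mono r \<and>
    (\<forall>x n. (\<forall>\<^sub>F k in sequentially. d (r k) \<in> B x n) \<or> (\<forall>\<^sub>F k in sequentially. d (r k) \<notin> B x n))"
proof -
  define \<S> where "\<S> = (\<lambda>(x, n). {k. d k \<in> B x n}) ` (points B \<times> UNIV)"
  have "small \<S>"
    unfolding \<S>_def by (intro small_image small_Times_nat assms)
  from small_family_not_splitting[OF assms(1) this]
  obtain D where "infinite D" and D: "\<forall>S\<in>\<S>. finite (D \<inter> S) \<or> finite (D - S)"
    by blast
  obtain r :: "nat \<Rightarrow> nat" where r: "strict_mono r" "\<forall>k. r k \<in> D"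
    using infinite_enumerate[OF \<open>infinite D\<close>] by blast
  have avoid: "\<forall>\<^sub>F k in sequentially. r k \<notin> F" if "finite F" for F
  proof -
    have "\<forall>\<^sub>F k in sequentially. k \<notin> F"
      using that by (simp add: cofinite_eq_sequentially[symmetric] eventually_cofinite)
    then show ?thesis
      using filterlim_subseq[OF r(1)] by (rule eventually_compose_filterlim)
  qed
  have "(\<forall>\<^sub>F k in sequentially. d (r k) \<in> B x n) \<or> (\<forall>\<^sub>F k in sequentially. d (r k) \<notin> B x n)"
    for x n
  proof (cases "x \<in> points B")
    case True
    then have "{k. d k \<in> B x n} \<in> \<S>"
      unfolding \<S>_def by force
    from bspec[OF D this] show ?thesis
    proof
      assume "finite (D \<inter> {k. d k \<in> B x n})"
      from avoid[OF this] show ?thesis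
        using r(2) by simp
    next
      assume "finite (D - {k. d k \<in> B x n})"
      from avoid[OF this] show ?thesis
        using r(2) by simp
    qed
  qed (simp add: outside)
  then show ?thesis
    using r(1) by blast
qed

text \<open>
  For fixed \<open>x\<close> and \<open>n\<close> there is a function \<open>f\<close> that works for all \<open>k\<close>, by the axioms \<open>base\<close> and \<open>closure\<close>,
  and larger functions work as well. There are fewer pairs \<open>(x, n)\<close> than the bounding number, so the
  functions obtained for them have a common eventual bound.
\<close>

lemma (in nbhd_system) shrinking_sequence:
  fixes d :: "nat \<Rightarrow> 'p"
  assumes "bounding_number =o continuum" and "small (points B)" and d: "\<And>k. d k \<in> points B"
  shows "\<exists>f. \<forall>x\<in>points B. \<forall>n. \<forall>\<^sub>F k in sequentially.
    (d k \<in> B x n \<longrightarrow> B (d k) (f k) \<subseteq> B x n) \<and> (d k \<notin> B x n \<longrightarrow> B (d k) (f k) \<inter> B x (Suc n) = {})"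
proof -
  define P where "P x n k m \<longleftrightarrow>
    (d k \<in> B x n \<longrightarrow> B (d k) m \<subseteq> B x n) \<and> (d k \<notin> B x n \<longrightarrow> B (d k) m \<inter> B x (Suc n) = {})"
    for x n k m
  have "\<exists>m. P x n k m" for x n k
    using base[of "d k" x n] closure[OF d, of k x n] unfolding P_def by blast
  then obtain g where g: "\<And>x n k. P x n k (g x n k)"
    by metis
  have P_mono: "P x n k m'" if "P x n k m" "m \<le> m'" for x n k m m'
    using that(1) antimono[OF that(2), of "d k"] unfolding P_def by blast
  define F where "F = (\<lambda>(x, n). g x n) ` (points B \<times> UNIV)"
  have "small F"
    unfolding F_def by (intro small_image small_Times_nat assms)
  from small_family_dominated[OF assms(1) this] obtain f where f: "\<forall>h\<in>F. h \<le>* f" ..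
  have "\<forall>\<^sub>F k in sequentially. P x n k (f k)" if "x \<in> points B" for x n
  proof -
    have "g x n \<in> F"
      using that unfolding F_def by force
    then have "\<forall>\<^sub>F k in sequentially. g x n k \<le> f k"
      using f unfolding eventually_dominated_def by blast
    then show ?thesis
      by eventually_elim (rule P_mono[OF g])
  qed
  then show ?thesis
    unfolding P_def by blast
qed

text \<open>
  The sequence \<open>d\<close> is made to converge to \<open>p\<close>. In the neighbourhoods of \<open>p\<close>, the summand \<open>n\<close> in
  \<open>f k + n\<close> makes the closure of each of them lie in the preceding one. An old neighbourhood takes in \<open>p\<close>
  if it contains almost all of \<open>d\<close>: it is then a neighbourhood of \<open>p\<close> too, and inclusion and
  disjointness of old neighbourhoods persist.
\<close>

definition adjoin ::
  "('p \<Rightarrow> nat \<Rightarrow> 'p set) \<Rightarrow> 'p \<Rightarrow> (nat \<Rightarrow> 'p) \<Rightarrow> (nat \<Rightarrow> nat) \<Rightarrow> 'p \<Rightarrow> nat \<Rightarrow> 'p set"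
where
  "adjoin B p d f x n =
    (if x = p then insert p (\<Union>k\<in>{n..}. B (d k) (f k + n))
     else B x n \<union> (if \<forall>\<^sub>F k in sequentially. d k \<in> B x n then {p} else {}))"

text \<open>
  The assumption \<open>diverges\<close> holds for an injective sequence without accumulation points. It keeps \<open>p\<close> apart
  from the old points.
\<close>

locale limit_adjunction = nbhd_system +
  fixes p d f
  assumes new: "p \<notin> points B"
    and seq: "d k \<in> points B"
    and diverges: "x \<in> points B \<Longrightarrow> \<exists>n. \<forall>\<^sub>F k in sequentially. d k \<notin> B x n"
    and unsplit: "(\<forall>\<^sub>F k in sequentially. d k \<in> B x n) \<or> (\<forall>\<^sub>F k in sequentially. d k \<notin> B x n)"
    and shrinking: "x \<in> points B \<Longrightarrow> \<forall>\<^sub>F k in sequentially.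
      (d k \<in> B x n \<longrightarrow> B (d k) (f k) \<subseteq> B x n) \<and> (d k \<notin> B x n \<longrightarrow> B (d k) (f k) \<inter> B x (Suc n) = {})"
begin

abbreviation B' where "B' \<equiv> adjoin B p d f"

lemma not_new: "p \<notin> B x n"
  using new within by blast

lemma mem_adjoin_old: "x \<noteq> p \<Longrightarrow> y \<noteq> p \<Longrightarrow> y \<in> B' x n \<longleftrightarrow> y \<in> B x n"
  by (simp add: adjoin_def)

lemma new_mem_adjoin: "x \<noteq> p \<Longrightarrow> p \<in> B' x n \<longleftrightarrow> (\<forall>\<^sub>F k in sequentially. d k \<in> B x n)"
  by (simp add: adjoin_def not_new)

lemma mem_adjoin_new: "y \<in> B' p n \<longleftrightarrow> y = p \<or> (\<exists>k\<ge>n. y \<in> B (d k) (f k + n))"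
  by (auto simp: adjoin_def)

lemma points_adjoin: "points B' = insert p (points B)"
  by (auto simp: points_def adjoin_def)

lemma eventually_not_both:
  assumes "\<forall>\<^sub>F k in sequentially. d k \<in> S" and "\<forall>\<^sub>F k in sequentially. d k \<notin> S'"
  shows "\<exists>k. d k \<in> S \<and> d k \<notin> S'"
  using eventually_happens[OF eventually_conj[OF assms]] by simp

text \<open>
  The following two lemmas are the two ways in which the neighbourhoods of \<open>p\<close> can relate to an old
  neighbourhood; by \<open>unsplit\<close> one of them always applies.
\<close>

lemma adjoin_new_subset:
  assumes "x \<in> points B" and "\<forall>\<^sub>F k in sequentially. d k \<in> B x n"
  shows "\<exists>m. B' p m \<subseteq> B' x n"
proof -
  have "x \<noteq> p"
    using assms(1) new by blast
  have "\<forall>\<^sub>F k in sequentially. B (d k) (f k) \<subseteq> B x n"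
    using assms(2) shrinking[OF assms(1), of n] by eventually_elim simp
  then obtain m where m: "\<forall>k\<ge>m. B (d k) (f k) \<subseteq> B x n"
    unfolding eventually_sequentially ..
  have "y \<in> B' x n" if y: "y \<in> B' p m" for y
  proof (cases "y = p")
    case True
    then show ?thesis
      using assms \<open>x \<noteq> p\<close> new_mem_adjoin by simp
  next
    case False
    then obtain k where "k \<ge> m" "y \<in> B (d k) (f k + m)"
      using y mem_adjoin_new by blast
    then have "y \<in> B x n"
      using m[rule_format, of k] antimono[of "f k" "f k + m" "d k"] by auto
    then show ?thesis
      using False \<open>x \<noteq> p\<close> mem_adjoin_old by simp
  qed
  then show ?thesis
    by blast
qed

lemma adjoin_new_disjoint:
  assumes "x \<in> points B" and "\<forall>\<^sub>F k in sequentially. d k \<notin> B x n"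
  shows "\<exists>m. B' p m \<inter> B' x (Suc n) = {}"
proof -
  have "x \<noteq> p"
    using assms(1) new by blast
  have p: "p \<notin> B' x (Suc n)"
  proof
    assume "p \<in> B' x (Suc n)"
    then obtain k where "d k \<in> B x (Suc n)" "d k \<notin> B x n"
      using eventually_not_both[OF _ assms(2)] new_mem_adjoin[OF \<open>x \<noteq> p\<close>] by metis
    then show False
      using decreasing by blast
  qed
  have "\<forall>\<^sub>F k in sequentially. B (d k) (f k) \<inter> B x (Suc n) = {}"
    using assms(2) shrinking[OF assms(1), of n] by eventually_elim simp
  then obtain m where m: "\<forall>k\<ge>m. B (d k) (f k) \<inter> B x (Suc n) = {}"
    unfolding eventually_sequentially ..
  have "y \<notin> B' x (Suc n)" if y: "y \<in> B' p m" for y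
  proof (cases "y = p")
    case True
    then show ?thesis
      using p by simp
  next
    case False
    then obtain k where "k \<ge> m" "y \<in> B (d k) (f k + m)"
      using y mem_adjoin_new by blast
    then have "y \<notin> B x (Suc n)"
      using m[rule_format, of k] antimono[of "f k" "f k + m" "d k"] by auto
    then show ?thesis
      using False \<open>x \<noteq> p\<close> mem_adjoin_old by simp
  qed
  then show ?thesis
    by blast
qed

lemma adjoin_subset:
  assumes "x \<noteq> p" and "y \<noteq> p" and "B y m \<subseteq> B x n"
  shows "B' y m \<subseteq> B' x n"
proof -
  have "(\<forall>\<^sub>F k in sequentially. d k \<in> B y m) \<longrightarrow> (\<forall>\<^sub>F k in sequentially. d k \<in> B x n)"
    using assms(3) by (auto elim: eventually_mono)
  then show ?thesis
    using assms by (auto simp: adjoin_def)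
qed

lemma adjoin_disjoint:
  assumes "x \<noteq> p" and "y \<noteq> p" and "B y m \<inter> B x n = {}"
  shows "B' y m \<inter> B' x n = {}"
proof -
  have "\<not> ((\<forall>\<^sub>F k in sequentially. d k \<in> B y m) \<and> (\<forall>\<^sub>F k in sequentially. d k \<in> B x n))"
  proof
    assume "(\<forall>\<^sub>F k in sequentially. d k \<in> B y m) \<and> (\<forall>\<^sub>F k in sequentially. d k \<in> B x n)"
    then have "\<forall>\<^sub>F k in sequentially. d k \<in> B y m \<and> d k \<in> B x n"
      by (simp add: eventually_conj)
    then obtain k where "d k \<in> B y m \<and> d k \<in> B x n"
      using eventually_happens by fastforce
    then show False
      using assms(3) by blast
  qed
  then show ?thesis
    using assms not_new by (auto simp: adjoin_def)
qed

lemma adjoin_closure_new: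
  assumes y: "y \<in> points B" and "y \<notin> B' p n"
  shows "\<exists>m. B' y m \<inter> B' p (Suc n) = {}"
proof -
  have "y \<noteq> p"
    using y new by blast
  obtain l where l: "\<forall>\<^sub>F k in sequentially. d k \<notin> B y l"
    using diverges[OF y] ..
  have "\<forall>\<^sub>F k in sequentially. B (d k) (f k) \<inter> B y (Suc l) = {}"
    using l shrinking[OF y, of l] by eventually_elim simp
  then obtain K where K: "\<forall>k\<ge>K. B (d k) (f k) \<inter> B y (Suc l) = {}"
    unfolding eventually_sequentially ..
  \<comment> \<open>Almost all of the sets forming \<open>B' p (Suc n)\<close> miss \<open>B y (Suc l)\<close>; each of the others misses some
    neighbourhood of \<open>y\<close>.\<close>
  have "\<exists>m. B y m \<inter> B (d k) (f k + Suc n) = {}" if "k \<ge> Suc n" for k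
  proof -
    have "y \<notin> B (d k) (f k + n)"
      using assms(2) that mem_adjoin_new Suc_leD by blast
    then show ?thesis
      using closure[OF y, of "d k" "f k + n"] by auto
  qed
  then obtain h where h: "\<And>k. k \<ge> Suc n \<Longrightarrow> B y (h k) \<inter> B (d k) (f k + Suc n) = {}"
    by metis
  define m where "m = Max (insert (Suc l) (h ` {..<K}))"
  have l_le: "Suc l \<le> m"
    unfolding m_def by (intro Max_ge) auto
  have *: "B y m \<inter> B (d k) (f k + Suc n) = {}" if k: "k \<ge> Suc n" for k
  proof (cases "k < K")
    case True
    then have "h k \<le> m"
      unfolding m_def by (intro Max_ge) auto
    then show ?thesis
      using h[OF k] antimono[of "h k" m y] by blast
  next
    case False
    then show ?thesis
      using K[rule_format, of k] antimono[OF l_le, of y] antimono[of "f k" "f k + Suc n" "d k"] by auto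
  qed
  have p: "p \<notin> B' y m"
  proof
    assume "p \<in> B' y m"
    then have "\<forall>\<^sub>F k in sequentially. d k \<in> B y m"
      using new_mem_adjoin[OF \<open>y \<noteq> p\<close>] by simp
    from eventually_not_both[OF this l] show False
      using antimono[of l m y] l_le by auto
  qed
  have "z \<notin> B' p (Suc n)" if z: "z \<in> B' y m" for z
  proof -
    have "z \<noteq> p"
      using z p by blast
    moreover have "z \<in> B y m"
      using z mem_adjoin_old[OF \<open>y \<noteq> p\<close> \<open>z \<noteq> p\<close>] by simp
    ultimately show ?thesis
      using * mem_adjoin_new by blast
  qed
  then show ?thesis
    by blast
qed

lemma nbhd_system_adjoin: "nbhd_system B'"
proof
  fix x y n
  show "B' x n = {}" if "x \<notin> points B'"
    using that outside by (simp add: points_adjoin adjoin_def)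
  show "x \<in> B' x n" if "x \<in> points B'"
    using that centre by (auto simp: points_adjoin adjoin_def)
  show "B' x n \<subseteq> points B'"
    using within unfolding points_adjoin adjoin_def by auto
  show "B' x (Suc n) \<subseteq> B' x n"
  proof (cases "x = p")
    case True
    have "B (d k) (f k + Suc n) \<subseteq> B (d k) (f k + n)" for k
      by (rule antimono) simp
    then show ?thesis
      using True mem_adjoin_new Suc_leD by blast
  next
    case False
    then show ?thesis
      by (intro adjoin_subset decreasing)
  qed
  show "\<exists>m. B' y m \<subseteq> B' x n" if y: "y \<in> B' x n"
  proof -
    consider "y = x" | "x = p" "y \<noteq> p" | "x \<noteq> p" "y = p" | "x \<noteq> p" "y \<noteq> p"
      by blast
    then show ?thesis
    proof cases
      case 1
      then show ?thesis
        by blast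
    next
      case 2
      then obtain k where k: "k \<ge> n" "y \<in> B (d k) (f k + n)"
        using y mem_adjoin_new by blast
      obtain m where m: "B y m \<subseteq> B (d k) (f k + n)"
        using base[OF k(2)] ..
      have "B' y m \<subseteq> B' p n"
      proof
        fix z
        assume "z \<in> B' y m"
        then show "z \<in> B' p n"
          using m k(1) mem_adjoin_old[OF \<open>y \<noteq> p\<close>] mem_adjoin_new by (cases "z = p") auto
      qed
      then show ?thesis
        using \<open>x = p\<close> by blast
    next
      case 3
      then have "\<forall>\<^sub>F k in sequentially. d k \<in> B x n"
        using y new_mem_adjoin by simp
      moreover have "x \<in> points B"
        using eventually_happens[OF calculation] outside[of x n] by auto
      ultimately show ?thesis
        using adjoin_new_subset 3 by blast
    next
      case 4
      then have "y \<in> B x n"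
        using y mem_adjoin_old by simp
      from base[OF this] obtain m where "B y m \<subseteq> B x n" ..
      then show ?thesis
        using adjoin_subset 4 by blast
    qed
  qed
  show "y \<in> B' x n" if y: "y \<in> points B'" and meet: "\<And>m. B' y m \<inter> B' x (Suc n) \<noteq> {}"
  proof (rule ccontr)
    assume not: "y \<notin> B' x n"
    consider "y = p" "x = p" | "x = p" "y \<noteq> p" | "x \<noteq> p" "y = p" | "x \<noteq> p" "y \<noteq> p"
      by blast
    then show False
    proof cases
      case 1
      then show False
        using not mem_adjoin_new by simp
    next
      case 2
      then show False
        using adjoin_closure_new[of y n] not y meet points_adjoin by auto
    next
      case 3
      have "\<forall>\<^sub>F k in sequentially. d k \<notin> B x n"
        using not 3 unsplit[of x n] new_mem_adjoin by auto
      moreover have "x \<in> points B"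
      proof (rule ccontr)
        assume "x \<notin> points B"
        then have "B' x (Suc n) = {}"
          using 3 by (simp add: adjoin_def outside)
        then show False
          using meet[of 0] by simp
      qed
      ultimately show False
        using adjoin_new_disjoint meet 3 by blast
    next
      case 4
      then have "y \<in> points B" "y \<notin> B x n"
        using y not mem_adjoin_old points_adjoin by auto
      then obtain m where "B y m \<inter> B x (Suc n) = {}"
        using closure by blast
      then show False
        using adjoin_disjoint 4 meet by blast
    qed
  qed
  show "\<exists>n. y \<notin> B' x n" if x: "x \<in> points B'" and "x \<noteq> y"
  proof -
    consider "x = p" "y \<in> points B" | "x = p" "y \<notin> points B'" | "x \<noteq> p" "y = p" | "x \<noteq> p" "y \<noteq> p"
      using \<open>x \<noteq> y\<close> by (auto simp: points_adjoin)
    then show ?thesis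
    proof cases
      case 1
      obtain l where "\<forall>\<^sub>F k in sequentially. d k \<notin> B y l"
        using diverges[OF 1(2)] ..
      from adjoin_new_disjoint[OF 1(2) this] obtain m where "B' p m \<inter> B' y (Suc l) = {}" ..
      moreover have "y \<in> B' y (Suc l)"
        using 1(2) centre[OF 1(2), of "Suc l"] new mem_adjoin_old by metis
      ultimately show ?thesis
        using 1(1) by blast
    next
      case 2
      then have "y \<noteq> p" and "y \<notin> B (d k) (f k + n)" for k
        using within points_adjoin by blast+
      then show ?thesis
        using 2 mem_adjoin_new by blast
    next
      case 3
      then have "x \<in> points B"
        using x points_adjoin by blast
      from diverges[OF this] obtain n where "\<forall>\<^sub>F k in sequentially. d k \<notin> B x n" ..
      then have "p \<notin> B' x n"
        using eventually_not_both new_mem_adjoin[OF \<open>x \<noteq> p\<close>] by blast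
      then show ?thesis
        using 3 by blast
    next
      case 4
      then have "x \<in> points B"
        using x points_adjoin by blast
      from t1[OF this \<open>x \<noteq> y\<close>] show ?thesis
        using mem_adjoin_old[OF 4] by simp
    qed
  qed
qed

lemma dense_extension_adjoin: "dense_extension B B'"
  unfolding dense_extension_def
proof (intro conjI ballI allI impI)
  show "points B \<subseteq> points B'"
    using points_adjoin by blast
  fix x n
  show "B' x n \<inter> points B = B x n" if "x \<in> points B"
    using that new within[of x n] by (auto simp: adjoin_def)
  show "B' y m \<subseteq> B' x n" if "x \<in> points B" "y \<in> points B" "B y m \<subseteq> B x n" for y m
    using that new by (intro adjoin_subset) auto
  show "B' x n \<inter> points B \<noteq> {}" if x: "x \<in> points B'"
  proof (cases "x = p")
    case True
    have "d n \<in> B' p n"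
      using centre[OF seq] mem_adjoin_new by blast
    then show ?thesis
      using True seq by blast
  next
    case False
    then have "x \<in> points B"
      using x points_adjoin by blast
    then show ?thesis
      using centre[of x n] False mem_adjoin_old by blast
  qed
qed

end

text \<open>
  An injective sequence in \<open>A\<close> is thinned out to an unsplit one. It diverges because \<open>A\<close> has no
  accumulation point, and the point \<open>p\<close> to which it is made to converge becomes one.
\<close>

theorem (in nbhd_system) adjoin_limit_point:
  assumes "bounding_number =o continuum" and "splitting_number =o continuum"
    and "small (points B)" and "p \<notin> points B"
    and A: "A \<subseteq> points B" "infinite A" "nbhd_topology derived_set_of A = {}"
  shows "\<exists>B'. nbhd_system B' \<and> dense_extension B B' \<and> points B' = insert p (points B) \<and>
    nbhd_system.nbhd_topology B' derived_set_of A \<noteq> {}"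
proof -
  obtain d0 :: "nat \<Rightarrow> 'p" where d0: "inj d0" "range d0 \<subseteq> A"
    using infinite_countable_subset[OF A(2)] by blast
  obtain r where r: "strict_mono r" and unsplit:
    "\<forall>x n. (\<forall>\<^sub>F k in sequentially. d0 (r k) \<in> B x n) \<or> (\<forall>\<^sub>F k in sequentially. d0 (r k) \<notin> B x n)"
    using unsplit_subsequence[OF assms(2,3), of d0] by blast
  define d where "d k = d0 (r k)" for k
  have "inj d"
    using d0(1) strict_mono_imp_inj_on[OF r] unfolding d_def inj_def by blast
  have d: "d k \<in> A" for k
    using d0(2) unfolding d_def by blast
  have dp: "d k \<in> points B" for k
    using d A(1) by blast
  obtain f where f: "\<forall>x\<in>points B. \<forall>n. \<forall>\<^sub>F k in sequentially.
    (d k \<in> B x n \<longrightarrow> B (d k) (f k) \<subseteq> B x n) \<and> (d k \<notin> B x n \<longrightarrow> B (d k) (f k) \<inter> B x (Suc n) = {})"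
    using shrinking_sequence[OF assms(1,3) dp] ..
  have diverges: "\<exists>n. \<forall>\<^sub>F k in sequentially. d k \<notin> B x n" if x: "x \<in> points B" for x
  proof -
    obtain n where n: "\<forall>y\<in>A. y \<noteq> x \<longrightarrow> y \<notin> B x n"
      using A(3) x unfolding derived_set_of_nbhd_topology by blast
    have "{k. d k \<in> B x n} \<subseteq> d -` {x}"
      using n d by auto
    moreover have "finite (d -` {x})"
      using \<open>inj d\<close> by (simp add: finite_vimageI)
    ultimately have "finite {k. d k \<in> B x n}"
      by (rule finite_subset)
    then have "\<forall>\<^sub>F k in sequentially. d k \<notin> B x n"
      by (simp add: cofinite_eq_sequentially[symmetric] eventually_cofinite)
    then show ?thesis ..
  qed
  interpret limit_adjunction B p d f
    using assms(4) dp diverges unsplit f by unfold_locales (simp_all add: d_def)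
  have "d n \<in> B' p n" for n
    using centre[OF dp] mem_adjoin_new by blast
  moreover have "d n \<noteq> p" for n
    using dp new by metis
  ultimately have "p \<in> nbhd_system.nbhd_topology B' derived_set_of A"
    using d unfolding nbhd_system.derived_set_of_nbhd_topology[OF nbhd_system_adjoin] points_adjoin
    by blast
  then show ?thesis
    using nbhd_system_adjoin dense_extension_adjoin points_adjoin by blast
qed

section \<open>Unions of chains\<close>

definition chain_union :: "('p \<Rightarrow> nat \<Rightarrow> 'p set) set \<Rightarrow> 'p \<Rightarrow> nat \<Rightarrow> 'p set" where
  "chain_union \<C> x n = (\<Union>B\<in>\<C>. B x n)"

lemma points_chain_union: "points (chain_union \<C>) = (\<Union>B\<in>\<C>. points B)"
  by (auto simp: points_def chain_union_def)

locale nbhd_chain =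
  fixes \<C> :: "('p \<Rightarrow> nat \<Rightarrow> 'p set) set"
  assumes systems: "B \<in> \<C> \<Longrightarrow> nbhd_system B"
    and comparable: "B \<in> \<C> \<Longrightarrow> B' \<in> \<C> \<Longrightarrow> dense_extension B B' \<or> dense_extension B' B"
begin

abbreviation U where "U \<equiv> chain_union \<C>"

lemma chain_union_trace:
  assumes B: "B \<in> \<C>" and x: "x \<in> points B"
  shows "U x n \<inter> points B = B x n"
proof
  show "B x n \<subseteq> U x n \<inter> points B"
    using B nbhd_system.within[OF systems[OF B]] unfolding chain_union_def by blast
  show "U x n \<inter> points B \<subseteq> B x n"
  proof
    fix y
    assume "y \<in> U x n \<inter> points B"
    then obtain B' where B': "B' \<in> \<C>" and y: "y \<in> B' x n" "y \<in> points B"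
      unfolding chain_union_def by blast
    from comparable[OF B B'] show "y \<in> B x n"
    proof
      assume "dense_extension B B'"
      from dense_extension_trace[OF this x] show ?thesis
        using y by blast
    next
      assume ext: "dense_extension B' B"
      have "x \<in> points B'"
        using y(1) nbhd_system.outside[OF systems[OF B'], of x n] by blast
      from dense_extension_trace[OF ext this] show ?thesis
        using y by blast
    qed
  qed
qed

lemma chain_union_subset:
  assumes B: "B \<in> \<C>" and x: "x \<in> points B" and y: "y \<in> points B" and sub: "B y m \<subseteq> B x n"
  shows "U y m \<subseteq> U x n"
proof
  fix z
  assume "z \<in> U y m"
  then obtain B' where B': "B' \<in> \<C>" and z: "z \<in> B' y m"
    unfolding chain_union_def by blast
  from comparable[OF B B'] show "z \<in> U x n"
  proof
    assume "dense_extension B B'"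
    from dense_extension_subset[OF this x y sub] show ?thesis
      using z B' unfolding chain_union_def by blast
  next
    assume ext: "dense_extension B' B"
    have "y \<in> points B'"
      using z nbhd_system.outside[OF systems[OF B'], of y m] by blast
    from dense_extension_trace[OF ext this] have "z \<in> B y m"
      using z by blast
    then show ?thesis
      using sub B unfolding chain_union_def by blast
  qed
qed

lemma chain_union_disjoint:
  assumes B: "B \<in> \<C>" and x: "x \<in> points B" and y: "y \<in> points B" and disj: "B x m \<inter> B y n = {}"
  shows "U x m \<inter> U y n = {}"
proof (rule ccontr)
  assume "U x m \<inter> U y n \<noteq> {}"
  then obtain z where z: "z \<in> U x m" "z \<in> U y n"
    by blast
  then obtain B' where B': "B' \<in> \<C>" and "z \<in> B' x m"
    unfolding chain_union_def by blast
  then have zB': "z \<in> points B'"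
    using nbhd_system.within[OF systems[OF B']] by blast
  from comparable[OF B B'] show False
  proof
    assume ext: "dense_extension B B'"
    then have "x \<in> points B'" "y \<in> points B'"
      using x y dense_extension_points by blast+
    then have "z \<in> B' x m \<inter> B' y n"
      using z zB' chain_union_trace[OF B'] by blast
    then show False
      using dense_extension_disjoint[OF systems[OF B'] ext x y disj] by blast
  next
    assume "dense_extension B' B"
    then have "z \<in> points B"
      using zB' dense_extension_points by blast
    then show False
      using z disj chain_union_trace[OF B x, of m] chain_union_trace[OF B y, of n] by blast
  qed
qed

lemma common_member:
  assumes "x \<in> points U" and "y \<in> points U"
  shows "\<exists>B\<in>\<C>. x \<in> points B \<and> y \<in> points B"
proof -
  obtain B B' where B: "B \<in> \<C>" "x \<in> points B" and B': "B' \<in> \<C>" "y \<in> points B'"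
    using assms unfolding points_chain_union by blast
  from comparable[OF B(1) B'(1)] show ?thesis
    using B B' dense_extension_points by blast
qed

lemma chain_union_outside:
  assumes "x \<notin> points U"
  shows "U x n = {}"
proof -
  have "B x n = {}" if B: "B \<in> \<C>" for B
  proof (rule nbhd_system.outside[OF systems[OF B]])
    show "x \<notin> points B"
      using assms B by (simp add: points_chain_union)
  qed
  then show ?thesis
    by (simp add: chain_union_def)
qed

lemma chain_union_within: "U x n \<subseteq> points U"
  unfolding points_chain_union chain_union_def
  by (intro UN_mono nbhd_system.within[OF systems]) auto

lemma nbhd_system_chain_union: "nbhd_system U"
proof
  fix x y n
  show "U x n = {}" if "x \<notin> points U"
    using that by (rule chain_union_outside)
  show "x \<in> U x n" if "x \<in> points U"
    using that by (auto simp: points_chain_union chain_union_def intro: nbhd_system.centre[OF systems])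
  show "U x n \<subseteq> points U"
    by (rule chain_union_within)
  show "U x (Suc n) \<subseteq> U x n"
    unfolding chain_union_def by (intro UN_mono nbhd_system.decreasing[OF systems]) auto
  show "\<exists>m. U y m \<subseteq> U x n" if y: "y \<in> U x n"
  proof -
    have "x \<in> points U"
      using y chain_union_outside by blast
    moreover have "y \<in> points U"
      using y chain_union_within by blast
    ultimately obtain B where B: "B \<in> \<C>" "x \<in> points B" "y \<in> points B"
      using common_member by blast
    then have "y \<in> B x n"
      using y chain_union_trace by blast
    from nbhd_system.base[OF systems[OF B(1)] this] obtain m where "B y m \<subseteq> B x n" ..
    from chain_union_subset[OF B this] show ?thesis ..
  qed
  show "y \<in> U x n" if y: "y \<in> points U" and meet: "\<And>m. U y m \<inter> U x (Suc n) \<noteq> {}"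
  proof -
    have "x \<in> points U"
      using meet[of 0] chain_union_outside by blast
    then obtain B where B: "B \<in> \<C>" "x \<in> points B" "y \<in> points B"
      using y common_member by blast
    have "B y m \<inter> B x (Suc n) \<noteq> {}" for m
      using meet[of m] chain_union_disjoint[OF B(1,3,2), of m "Suc n"] by blast
    from nbhd_system.closure[OF systems[OF B(1)] B(3) this] show ?thesis
      using B(1) unfolding chain_union_def by blast
  qed
  show "\<exists>n. y \<notin> U x n" if x: "x \<in> points U" and "x \<noteq> y"
  proof (cases "y \<in> points U")
    case True
    then obtain B where B: "B \<in> \<C>" "x \<in> points B" "y \<in> points B"
      using x common_member by blast
    obtain n where "y \<notin> B x n"
      using nbhd_system.t1[OF systems[OF B(1)] B(2) \<open>x \<noteq> y\<close>] ..
    then have "y \<notin> U x n"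
      using chain_union_trace[OF B(1,2), of n] B(3) by blast
    then show ?thesis ..
  next
    case False
    then show ?thesis
      using chain_union_within by blast
  qed
qed

lemma dense_extension_chain_union:
  assumes B: "B \<in> \<C>"
  shows "dense_extension B U"
  unfolding dense_extension_def
proof (intro conjI ballI allI impI)
  show "points B \<subseteq> points U"
    using B by (auto simp: points_chain_union)
  show "U x n \<inter> points B \<noteq> {}" if x: "x \<in> points U" for x n
  proof -
    obtain B' where B': "B' \<in> \<C>" "x \<in> points B'"
      using x by (auto simp: points_chain_union)
    from comparable[OF B B'(1)] show ?thesis
    proof
      assume "dense_extension B B'"
      from dense_extension_meets[OF this B'(2)] show ?thesis
        using B'(1) unfolding chain_union_def by blast
    next
      assume "dense_extension B' B"
      then have "x \<in> points B"
        using B'(2) dense_extension_points by blast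
      then show ?thesis
        using nbhd_system.centre[OF nbhd_system_chain_union x] by blast
    qed
  qed
qed (use B chain_union_trace chain_union_subset in \<open>simp_all\<close>)

end

section \<open>The transfinite construction\<close>

text \<open>
  A well-order of type continuum, given by its initial segments \<open>L \<alpha>\<close>.
\<close>

lemma continuum_well_order:
  obtains L :: "nat set \<Rightarrow> nat set set"
  where "wf {(\<beta>, \<alpha>). \<beta> \<in> L \<alpha>}"
    and "\<And>\<alpha> \<beta> \<gamma>. \<gamma> \<in> L \<beta> \<Longrightarrow> \<beta> \<in> L \<alpha> \<Longrightarrow> \<gamma> \<in> L \<alpha>"
    and "\<And>\<alpha> \<beta>. \<alpha> = \<beta> \<or> \<alpha> \<in> L \<beta> \<or> \<beta> \<in> L \<alpha>"
    and "\<And>\<alpha>. small (L \<alpha>)"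
proof -
  let ?r = "|UNIV :: nat set set|"
  have wo: "Well_order ?r" and field: "Field ?r = UNIV"
    by (rule card_of_Well_order) (rule Field_card_of)
  show thesis
  proof (rule that[of "underS ?r"])
    have "{(\<beta>, \<alpha>). \<beta> \<in> underS ?r \<alpha>} = ?r - Id"
      by (auto simp: underS_def)
    then show "wf {(\<beta>, \<alpha>). \<beta> \<in> underS ?r \<alpha>}"
      using wo by (simp add: well_order_on_def)
    have "trans ?r" "antisym ?r" "Total ?r"
      using wo by (simp_all add: order_on_defs)
    show "\<gamma> \<in> underS ?r \<alpha>" if "\<gamma> \<in> underS ?r \<beta>" "\<beta> \<in> underS ?r \<alpha>" for \<alpha> \<beta> \<gamma>
      using that transD[OF \<open>trans ?r\<close>, of \<gamma> \<beta> \<alpha>] antisymD[OF \<open>antisym ?r\<close>, of \<beta> \<gamma>]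
      unfolding underS_def by auto
    show "\<alpha> = \<beta> \<or> \<alpha> \<in> underS ?r \<beta> \<or> \<beta> \<in> underS ?r \<alpha>" for \<alpha> \<beta>
      using \<open>Total ?r\<close> field unfolding underS_def total_on_def by auto
    show "small (underS ?r \<alpha>)" for \<alpha>
      by (rule card_of_underS[OF card_of_Card_order]) (simp add: field)
  qed
qed

text \<open>
  The coordinate \<open>0\<close> of \<open>\<alpha>\<close> is left out, so that each sequence is listed by continuum many \<open>\<alpha>\<close>.
\<close>

definition listed :: "nat set \<Rightarrow> nat set set" where
  "listed \<alpha> = range (\<lambda>n. decode \<alpha> (Suc n))"

text \<open>
  The coordinates \<open>0\<close> of the sets that do not come after all \<open>\<beta> n\<close> form a countable union of small
  sets, so some value \<open>t\<close> of this coordinate is free, and prepending \<open>t\<close> to \<open>s\<close> yields \<open>\<alpha>\<close>.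
\<close>

lemma countable_sets_listed_late:
  fixes L :: "nat set \<Rightarrow> nat set set" and s \<beta> :: "nat \<Rightarrow> nat set"
  assumes small: "\<And>\<alpha>. small (L \<alpha>)" and total: "\<And>\<alpha> \<beta>. \<alpha> = \<beta> \<or> \<alpha> \<in> L \<beta> \<or> \<beta> \<in> L \<alpha>"
  shows "\<exists>\<alpha>. listed \<alpha> = range s \<and> (\<forall>n. \<beta> n \<in> L \<alpha>)"
proof -
  define A where "A n = (\<lambda>\<alpha>. decode \<alpha> 0) ` (L (\<beta> n) \<union> {\<beta> n})" for n
  have "small {\<beta> n}" for n
    using small_image[OF small_nat, of "\<lambda>_. \<beta> n"] by simp
  then have "small (A n)" for n
    unfolding A_def by (intro small_image small_Un small)
  from continuum_not_countable_union_of_small[of A, OF this]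
  obtain t where t: "\<And>n. t \<notin> A n"
    by auto
  define \<alpha> where "\<alpha> = encode (case_nat t s)"
  have "decode \<alpha> 0 = t"
    by (simp add: \<alpha>_def)
  have "\<beta> n \<in> L \<alpha>" for n
  proof -
    have "\<alpha> \<notin> L (\<beta> n) \<union> {\<beta> n}"
      using t[of n] \<open>decode \<alpha> 0 = t\<close> unfolding A_def by blast
    then show ?thesis
      using total[of \<alpha> "\<beta> n"] by blast
  qed
  moreover have "listed \<alpha> = range s"
    by (simp add: listed_def \<alpha>_def)
  ultimately show ?thesis
    by blast
qed

text \<open>
  At stage \<open>\<alpha>\<close> the union of all earlier stages is formed and, if \<open>listed \<alpha>\<close> is an infinite subset of it
  without accumulation point, the point \<open>new \<alpha>\<close> is adjoined as one. This union has at most \<open>|L \<alpha>|\<close> new points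
  besides the original ones, so it is small and the step is possible.
\<close>

theorem countably_compact_dense_extension:
  fixes B0 :: "nat set \<Rightarrow> nat \<Rightarrow> nat set set" and new :: "nat set \<Rightarrow> nat set"
  assumes b: "bounding_number =o continuum" and s: "splitting_number =o continuum"
    and B0: "nbhd_system B0" and small: "small (points B0)"
    and "inj new" and disj: "range new \<inter> points B0 = {}"
  shows "\<exists>B. nbhd_system B \<and> dense_extension B0 B \<and>
    countably_compact_space (nbhd_system.nbhd_topology B)"
proof -
  obtain L :: "nat set \<Rightarrow> nat set set" where wf: "wf {(\<beta>, \<alpha>). \<beta> \<in> L \<alpha>}"
    and L_trans: "\<And>\<alpha> \<beta> \<gamma>. \<gamma> \<in> L \<beta> \<Longrightarrow> \<beta> \<in> L \<alpha> \<Longrightarrow> \<gamma> \<in> L \<alpha>"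
    and L_total: "\<And>\<alpha> \<beta>. \<alpha> = \<beta> \<or> \<alpha> \<in> L \<beta> \<or> \<beta> \<in> L \<alpha>"
    and L_small: "\<And>\<alpha>. small (L \<alpha>)"
    using continuum_well_order by blast
  \<comment> \<open>The requirement on the step from \<open>B\<close>, the union of the earlier stages, to the stage \<open>B'\<close> at \<open>\<alpha>\<close>.\<close>
  define P where "P \<alpha> B B' \<longleftrightarrow> nbhd_system B' \<and> dense_extension B B' \<and>
    points B' \<subseteq> insert (new \<alpha>) (points B) \<and>
    (listed \<alpha> \<subseteq> points B \<and> infinite (listed \<alpha>) \<longrightarrow>
      nbhd_system.nbhd_topology B' derived_set_of listed \<alpha> \<noteq> {})" for \<alpha> B B'
  have step: "\<exists>B'. P \<alpha> B B'" if B: "nbhd_system B" "small (points B)" "new \<alpha> \<notin> points B" for \<alpha> B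
  proof (cases "listed \<alpha> \<subseteq> points B \<and> infinite (listed \<alpha>) \<and>
      nbhd_system.nbhd_topology B derived_set_of listed \<alpha> = {}")
    case True
    then obtain B' where "nbhd_system B'" "dense_extension B B'"
      "points B' = insert (new \<alpha>) (points B)"
      "nbhd_system.nbhd_topology B' derived_set_of listed \<alpha> \<noteq> {}"
      using nbhd_system.adjoin_limit_point[OF B(1) b s B(2,3), of "listed \<alpha>"] by auto
    then have "P \<alpha> B B'"
      by (simp add: P_def)
    then show ?thesis
      by (rule exI[of "P \<alpha> B"])
  next
    case False
    then have "P \<alpha> B B"
      using B(1) dense_extension_refl[OF B(1)] by (auto simp: P_def)
    then show ?thesis
      by (rule exI[of "P \<alpha> B"])
  qed
  define F where "F T \<alpha> = (SOME B'. P \<alpha> (chain_union (insert B0 (T ` L \<alpha>))) B')" for T \<alpha>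
  define T where "T = wfrec {(\<beta>, \<alpha>). \<beta> \<in> L \<alpha>} F"
  have T: "T \<alpha> = F T \<alpha>" for \<alpha>
  proof -
    have "cut T {(\<beta>, \<alpha>). \<beta> \<in> L \<alpha>} \<alpha> ` L \<alpha> = T ` L \<alpha>"
      by (intro image_cong) (simp_all add: cut_apply)
    then show ?thesis
      using wfrec[OF wf, of F \<alpha>] unfolding T_def F_def by simp
  qed
  define stage where "stage \<alpha> = chain_union (insert B0 (T ` L \<alpha>))" for \<alpha>
  define good where "good \<alpha> \<longleftrightarrow> P \<alpha> (stage \<alpha>) (T \<alpha>) \<and> dense_extension B0 (T \<alpha>) \<and>
    (\<forall>\<beta>\<in>L \<alpha>. dense_extension (T \<beta>) (T \<alpha>)) \<and>
    points (T \<alpha>) \<subseteq> points B0 \<union> new ` insert \<alpha> (L \<alpha>)" for \<alpha>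
  have chain: "nbhd_chain (insert B0 (T ` S))" if S: "\<And>\<alpha>. \<alpha> \<in> S \<Longrightarrow> good \<alpha>" for S
  proof (rule nbhd_chain.intro)
    have sys: "nbhd_system (T \<alpha>)" if "\<alpha> \<in> S" for \<alpha>
      using S[OF that] by (simp add: good_def P_def)
    then show "nbhd_system B" if "B \<in> insert B0 (T ` S)" for B
      using that B0 by blast
    have comparable: "dense_extension (T \<alpha>) (T \<beta>) \<or> dense_extension (T \<beta>) (T \<alpha>)"
      if "\<alpha> \<in> S" "\<beta> \<in> S" for \<alpha> \<beta>
      using L_total[of \<alpha> \<beta>] S[OF \<open>\<alpha> \<in> S\<close>] S[OF \<open>\<beta> \<in> S\<close>] dense_extension_refl[OF sys[OF \<open>\<alpha> \<in> S\<close>]]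
      unfolding good_def by blast
    have "dense_extension B0 (T \<alpha>)" if "\<alpha> \<in> S" for \<alpha>
      using S[OF that] by (simp add: good_def)
    then show "dense_extension B B' \<or> dense_extension B' B"
      if "B \<in> insert B0 (T ` S)" "B' \<in> insert B0 (T ` S)" for B B'
      using that comparable dense_extension_refl[OF B0] by auto
  qed
  have good: "good \<alpha>" for \<alpha>
    using wf
  proof (induction \<alpha> rule: wf_induct_rule)
    case (less \<alpha>)
    then have IH: "\<And>\<beta>. \<beta> \<in> L \<alpha> \<Longrightarrow> good \<beta>"
      by simp
    interpret nbhd_chain "insert B0 (T ` L \<alpha>)"
      using IH by (rule chain)
    have "\<alpha> \<notin> L \<alpha>"
      using wf by (metis case_prodI mem_Collect_eq wf_not_refl)
    have pts: "points (stage \<alpha>) \<subseteq> points B0 \<union> new ` L \<alpha>"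
    proof -
      have "points (T \<beta>) \<subseteq> points B0 \<union> new ` L \<alpha>" if "\<beta> \<in> L \<alpha>" for \<beta>
      proof -
        have "insert \<beta> (L \<beta>) \<subseteq> L \<alpha>"
          using that L_trans by blast
        then show ?thesis
          using IH[OF that] unfolding good_def by blast
      qed
      then show ?thesis
        unfolding stage_def points_chain_union by blast
    qed
    have "small (points (stage \<alpha>))"
      by (rule small_subset[OF _ pts]) (intro small_Un small small_image L_small)
    moreover have "new \<alpha> \<notin> points (stage \<alpha>)"
      using pts disj \<open>\<alpha> \<notin> L \<alpha>\<close> injD[OF \<open>inj new\<close>] by blast
    moreover have "nbhd_system (stage \<alpha>)"
      unfolding stage_def by (rule nbhd_system_chain_union)
    ultimately have "\<exists>B'. P \<alpha> (stage \<alpha>) B'"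
      by (intro step)
    then have P: "P \<alpha> (stage \<alpha>) (T \<alpha>)"
      unfolding T[of \<alpha>] F_def stage_def[symmetric] by (rule someI_ex)
    have ext: "dense_extension B (T \<alpha>)" if "B \<in> insert B0 (T ` L \<alpha>)" for B
      using dense_extension_trans[OF _ dense_extension_chain_union[OF that]] P
      unfolding P_def stage_def by blast
    have "points (T \<alpha>) \<subseteq> points B0 \<union> new ` insert \<alpha> (L \<alpha>)"
      using P pts unfolding P_def by blast
    then show "good \<alpha>"
      using P ext unfolding good_def by blast
  qed
  define B where "B = chain_union (insert B0 (range T))"
  interpret C: nbhd_chain "insert B0 (range T)"
    by (rule chain) (rule good)
  have B: "nbhd_system B"
    unfolding B_def by (rule C.nbhd_system_chain_union)
  have ext: "dense_extension B0 B" "dense_extension (T \<alpha>) B" for \<alpha>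
    unfolding B_def by (rule C.dense_extension_chain_union; simp)+
  have "nbhd_system.nbhd_topology B derived_set_of A \<noteq> {}"
    if A: "A \<subseteq> points B" "countable A" "infinite A" for A
  proof -
    define s where "s = from_nat_into A"
    have s: "range s = A"
      unfolding s_def using A by (intro range_from_nat_into) auto
    have "\<exists>\<beta>. s n \<in> points (T \<beta>)" for n
    proof -
      (* The stage at {} is an arbitrary one; all stages contain the points of B0. *)
      have "s n \<in> points B"
        using s A(1) by blast
      moreover have "points B0 \<subseteq> points (T {})"
        using good[of "{}"] dense_extension_points unfolding good_def by blast
      ultimately show ?thesis
        unfolding B_def points_chain_union by blast
    qed
    then obtain \<beta> where \<beta>: "\<And>n. s n \<in> points (T (\<beta> n))"
      by metis
    obtain \<alpha> where \<alpha>: "listed \<alpha> = range s" "\<forall>n. \<beta> n \<in> L \<alpha>"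
      using countable_sets_listed_late[of L s \<beta>, OF L_small L_total] by blast
    have "A \<subseteq> points (stage \<alpha>)"
      unfolding s[symmetric] stage_def points_chain_union using \<beta> \<alpha>(2) by blast
    then have "nbhd_system.nbhd_topology (T \<alpha>) derived_set_of A \<noteq> {}"
      using good[of \<alpha>] \<alpha>(1) s A(3) unfolding good_def P_def by auto
    moreover have "nbhd_system (T \<alpha>)"
      using good[of \<alpha>] unfolding good_def P_def by blast
    ultimately show ?thesis
      using derived_set_of_dense_extension B ext(2) by blast
  qed
  then have "countably_compact_space (nbhd_system.nbhd_topology B)"
    unfolding countably_compact_space_def nbhd_system.topspace_nbhd_topology[OF B] by blast
  then show ?thesis
    using B ext(1) by blast
qed

section \<open>First countable regular spaces\<close>

text \<open>
  Given a countable base at \<open>x\<close>, each \<open>u (Suc n)\<close> is chosen by regularity inside the intersection of \<open>u n\<close>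
  with the next base set.
\<close>

lemma shrinking_local_base:
  assumes X: "first_countable X" "regular_space X" and x: "x \<in> topspace X"
  shows "\<exists>u. \<forall>n. openin X (u n) \<and> x \<in> u n \<and> X closure_of u (Suc n) \<subseteq> u n \<and>
    (\<forall>U. openin X U \<and> x \<in> U \<longrightarrow> (\<exists>n. u n \<subseteq> U))"
proof -
  obtain \<B> where \<B>: "countable \<B>" "\<forall>V\<in>\<B>. openin X V"
    "\<forall>U. openin X U \<and> x \<in> U \<longrightarrow> (\<exists>V\<in>\<B>. x \<in> V \<and> V \<subseteq> U)"
    using X(1) x unfolding first_countable_def by meson
  have "\<B> \<noteq> {}"
    using \<B>(3) x openin_topspace by blast
  \<comment> \<open>Members of the base that do not contain \<open>x\<close> are replaced by the whole space, so that each
    \<open>g n\<close> is a neighbourhood of \<open>x\<close>.\<close>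
  define g where "g n = (if x \<in> from_nat_into \<B> n then from_nat_into \<B> n else topspace X)" for n
  have g: "openin X (g n)" "x \<in> g n" for n
    using \<B>(2) from_nat_into[OF \<open>\<B> \<noteq> {}\<close>, of n] x by (simp_all add: g_def)
  have g_base: "\<exists>n. g n \<subseteq> U" if U: "openin X U" "x \<in> U" for U
  proof -
    obtain V where V: "V \<in> \<B>" "x \<in> V" "V \<subseteq> U"
      using \<B>(3) U by blast
    obtain n where "from_nat_into \<B> n = V"
      using from_nat_into_surj[OF \<B>(1) V(1)] ..
    then have "g n \<subseteq> U"
      using V by (simp add: g_def)
    then show ?thesis ..
  qed
  have "\<exists>u. \<forall>n. (openin X (u n) \<and> x \<in> u n \<and> u n \<subseteq> g n) \<and> X closure_of u (Suc n) \<subseteq> u n"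
  proof (rule dependent_nat_choice)
    show "\<exists>S. openin X S \<and> x \<in> S \<and> S \<subseteq> g 0"
      using g by blast
    fix S n
    assume S: "openin X S \<and> x \<in> S \<and> S \<subseteq> g n"
    have "openin X (S \<inter> g (Suc n)) \<and> x \<in> S \<inter> g (Suc n)"
      using S g by blast
    then obtain V C where V: "openin X V" "closedin X C" "x \<in> V" "V \<subseteq> C" "C \<subseteq> S \<inter> g (Suc n)"
      using X(2) unfolding neighbourhood_base_of_closedin[symmetric] neighbourhood_base_of by meson
    have "X closure_of V \<subseteq> C"
      using V(4,2) by (rule closure_of_minimal)
    then show "\<exists>T. (openin X T \<and> x \<in> T \<and> T \<subseteq> g (Suc n)) \<and> X closure_of T \<subseteq> S"
      using V by (intro exI[of _ V]) auto
  qed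
  then obtain u where u: "\<forall>n. (openin X (u n) \<and> x \<in> u n \<and> u n \<subseteq> g n) \<and> X closure_of u (Suc n) \<subseteq> u n" ..
  have "\<exists>n. u n \<subseteq> U" if "openin X U" "x \<in> U" for U
    using g_base[OF that] u by (meson subset_trans)
  then show ?thesis
    using u by (intro exI[of _ u]) simp
qed

theorem nbhd_system_of_first_countable_regular:
  assumes X: "first_countable X" "regular_T1_space X"
  shows "\<exists>B. nbhd_system B \<and> nbhd_system.nbhd_topology B = X"
proof -
  have "\<exists>u. \<forall>n. openin X (u n) \<and> x \<in> u n \<and> X closure_of u (Suc n) \<subseteq> u n \<and>
    (\<forall>U. openin X U \<and> x \<in> U \<longrightarrow> (\<exists>n. u n \<subseteq> U))" if "x \<in> topspace X" for x
    using X that by (intro shrinking_local_base) (simp_all add: regular_T1_space_def)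
  then obtain u where u: "\<And>x n. x \<in> topspace X \<Longrightarrow> openin X (u x n) \<and> x \<in> u x n \<and>
      X closure_of u x (Suc n) \<subseteq> u x n \<and> (\<forall>U. openin X U \<and> x \<in> U \<longrightarrow> (\<exists>n. u x n \<subseteq> U))"
    by metis
  define B where "B x n = (if x \<in> topspace X then u x n else {})" for x n
  have B_open: "openin X (B x n)" for x n
    using u by (simp add: B_def)
  have B_sub: "B x n \<subseteq> topspace X" for x n
    using B_open by (rule openin_subset)
  have B_centre: "x \<in> B x n" if "x \<in> topspace X" for x n
    using u that by (simp add: B_def)
  have B_base: "\<exists>n. B x n \<subseteq> U" if "openin X U" "x \<in> U" for x U
    using u[of x] that openin_subset[OF that(1)] by (simp add: B_def subset_iff)
  have B_closure: "X closure_of B x (Suc n) \<subseteq> B x n" for x n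
    using u by (simp add: B_def)
  have points: "points B = topspace X"
    using B_centre B_sub unfolding points_def by blast
  have B: "nbhd_system B"
  proof
    fix x y n
    show "B x n = {}" if "x \<notin> points B"
      using that by (simp add: points B_def)
    show "x \<in> B x n" if "x \<in> points B"
      using that B_centre by (simp add: points)
    show "B x n \<subseteq> points B"
      using B_sub by (simp add: points)
    show "B x (Suc n) \<subseteq> B x n"
      using closure_of_subset[OF B_sub] B_closure by (rule subset_trans)
    show "\<exists>m. B y m \<subseteq> B x n" if "y \<in> B x n"
      using B_open that by (rule B_base)
    show "y \<in> B x n" if y: "y \<in> points B" and meet: "\<And>m. B y m \<inter> B x (Suc n) \<noteq> {}"
    proof -
      have "\<exists>z\<in>B x (Suc n). z \<in> T" if "y \<in> T" "openin X T" for T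
        using B_base[OF that(2,1)] meet by blast
      then have "y \<in> X closure_of B x (Suc n)"
        using y by (simp add: in_closure_of points) blast
      then show ?thesis
        using B_closure by blast
    qed
    show "\<exists>n. y \<notin> B x n" if xy: "x \<in> points B" "x \<noteq> y"
    proof (cases "y \<in> topspace X")
      case True
      then obtain U where U: "openin X U" "x \<in> U" "y \<notin> U"
        using X(2) xy True unfolding regular_T1_space_def t1_space_def points by meson
      from B_base[OF this(1,2)] show ?thesis
        using U(3) by blast
    next
      case False
      then show ?thesis
        using B_sub by blast
    qed
  qed
  then interpret nbhd_system B .
  have "openin nbhd_topology U \<longleftrightarrow> openin X U" for U
  proof
    assume U: "openin nbhd_topology U"
    have "\<exists>T. openin X T \<and> x \<in> T \<and> T \<subseteq> U" if x: "x \<in> U" for x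
    proof -
      obtain n where "B x n \<subseteq> U" "x \<in> points B"
        using U x unfolding openin_nbhd_topology by blast
      then show ?thesis
        using B_open B_centre by (intro exI[of _ "B x n"]) (simp add: points)
    qed
    then show "openin X U"
      by (subst openin_subopen) blast
  next
    assume "openin X U"
    then show "openin nbhd_topology U"
      unfolding openin_nbhd_topology points by (simp add: B_base openin_subset)
  qed
  then have "nbhd_topology = X"
    by (simp add: topology_eq)
  then show ?thesis
    using B by blast
qed

lemma nbhd_system_homeomorphic_copy:
  assumes "nbhd_system B" and inj: "inj_on h (points B)"
  shows "\<exists>B'. nbhd_system B' \<and> points B' = h ` points B \<and>
    homeomorphic_map (nbhd_system.nbhd_topology B) (nbhd_system.nbhd_topology B') h"
proof -
  interpret nbhd_system B by fact
  define B' where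
    "B' y n = (if y \<in> h ` points B then h ` B (inv_into (points B) h y) n else {})" for y n
  have B'_h: "B' (h x) n = h ` B x n" if "x \<in> points B" for x n
    using that inj by (simp add: B'_def)
  have mem: "h y \<in> B' (h x) n \<longleftrightarrow> y \<in> B x n" if "x \<in> points B" "y \<in> points B" for x y n
    unfolding B'_h[OF that(1)] using inj_on_image_mem_iff[OF inj that(2) within] .
  have out: "B' y n = {}" if "y \<notin> h ` points B" for y n
    using that by (simp add: B'_def)
  have sub: "B' y n \<subseteq> h ` points B" for y n
    using within by (auto simp: B'_def)
  have points: "points B' = h ` points B"
  proof
    show "points B' \<subseteq> h ` points B"
      using sub unfolding points_def[of B'] by blast
    show "h ` points B \<subseteq> points B'"
      using mem centre unfolding points_def[of B'] by blast
  qed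
  have disjoint: "B' (h x) m \<inter> B' (h y) n = h ` (B x m \<inter> B y n)"
    if "x \<in> points B" "y \<in> points B" for x y m n
    unfolding B'_h[OF that(1)] B'_h[OF that(2)]
    by (rule inj_on_image_Int[OF inj within within, symmetric])
  have B': "nbhd_system B'"
  proof
    fix x y n
    show "B' x n = {}" if "x \<notin> points B'"
      using that out points by blast
    show "x \<in> B' x n" if "x \<in> points B'"
      using that mem centre unfolding points by blast
    show "B' x n \<subseteq> points B'"
      using sub points by blast
    show "B' x (Suc n) \<subseteq> B' x n"
      using decreasing by (auto simp: B'_def)
    show "\<exists>m. B' y m \<subseteq> B' x n" if y: "y \<in> B' x n"
    proof -
      obtain x' where x': "x' \<in> points B" "x = h x'"
        using y out by blast
      then obtain y' where y': "y' \<in> B x' n" "y = h y'"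
        using y B'_h by auto
      obtain m where "B y' m \<subseteq> B x' n"
        using base[OF y'(1)] ..
      moreover have "y' \<in> points B"
        using y'(1) within by blast
      ultimately have "B' y m \<subseteq> B' x n"
        unfolding x' y' using B'_h x'(1) by (simp add: image_mono)
      then show ?thesis ..
    qed
    show "y \<in> B' x n" if y: "y \<in> points B'" and meet: "\<And>m. B' y m \<inter> B' x (Suc n) \<noteq> {}"
    proof -
      obtain x' where x': "x' \<in> points B" "x = h x'"
        using meet[of 0] out by blast
      obtain y' where y': "y' \<in> points B" "y = h y'"
        using y points by blast
      have "B y' m \<inter> B x' (Suc n) \<noteq> {}" for m
        using meet[of m] unfolding x' y' disjoint[OF y'(1) x'(1)] by blast
      from closure[OF y'(1) this] show ?thesis
        unfolding x' y' mem[OF x'(1) y'(1)] .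
    qed
    show "\<exists>n. y \<notin> B' x n" if x: "x \<in> points B'" and "x \<noteq> y"
    proof (cases "y \<in> points B'")
      case True
      obtain x' where x': "x' \<in> points B" "x = h x'"
        using x points by blast
      obtain y' where y': "y' \<in> points B" "y = h y'"
        using True points by blast
      have "x' \<noteq> y'"
        using \<open>x \<noteq> y\<close> x' y' by blast
      from t1[OF x'(1) this] show ?thesis
        unfolding x' y' mem[OF x'(1) y'(1)] .
    next
      case False
      then show ?thesis
        using sub points by blast
    qed
  qed
  interpret B': nbhd_system B' by (rule B')
  have open_iff: "openin B'.nbhd_topology (h ` U) \<longleftrightarrow> openin nbhd_topology U" if "U \<subseteq> points B" for U
  proof -
    have "B' (h x) n \<subseteq> h ` U \<longleftrightarrow> B x n \<subseteq> U" if "x \<in> U" for x n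
    proof -
      have "x \<in> points B"
        using that \<open>U \<subseteq> points B\<close> by blast
      then show ?thesis
        using inj_on_image_subset_iff[OF inj within \<open>U \<subseteq> points B\<close>] B'_h by simp
    qed
    then show ?thesis
      unfolding openin_nbhd_topology B'.openin_nbhd_topology points using that by auto
  qed
  have "homeomorphic_map nbhd_topology B'.nbhd_topology h"
  proof (rule bijective_open_imp_homeomorphic_map)
    show "continuous_map nbhd_topology B'.nbhd_topology h"
      unfolding continuous_map_def topspace_nbhd_topology B'.topspace_nbhd_topology
    proof (intro conjI allI impI)
      show "h \<in> points B \<rightarrow> points B'"
        using points by blast
      fix V
      assume V: "openin B'.nbhd_topology V"
      have "h ` {x \<in> points B. h x \<in> V} = V"
        using V unfolding B'.openin_nbhd_topology points by blast
      then show "openin nbhd_topology {x \<in> points B. h x \<in> V}"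
        using open_iff[of "{x \<in> points B. h x \<in> V}"] V by simp
    qed
    show "open_map nbhd_topology B'.nbhd_topology h"
      unfolding open_map_def using open_iff openin_nbhd_topology by blast
  qed (use inj points in \<open>simp_all add: topspace_nbhd_topology B'.topspace_nbhd_topology\<close>)
  then show ?thesis
    using B' points by blast
qed

section \<open>Countably compact extensions of first countable regular spaces\<close>

theorem theorem2p1:
  fixes X :: "'a topology"
  assumes "bounding_number =o continuum"
    and "splitting_number =o continuum"
    and "first_countable X"
    and "regular_T1_space X"
    and "|topspace X| <o continuum"
  shows "\<exists>(Y :: nat set topology) e.
           first_countable Y \<and> countably_compact_space Y \<and> regular_T1_space Y \<and>
           dense_embedding X Y e"
proof -
  have small: "small (topspace X)"
    using assms(5) ordIso_symmetric[OF card_nat_sets_continuum] by (rule ordLess_ordIso_trans)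
  then obtain i :: "'a \<Rightarrow> nat set" where i: "inj_on i (topspace X)"
    using card_of_ordLeq[of "topspace X" "UNIV :: nat set set"] ordLess_imp_ordLeq by blast
  \<comment> \<open>Sets without \<open>0\<close> stand for points of \<open>X\<close>, which leaves the sets with \<open>0\<close> for the points to be adjoined.\<close>
  define old where "old S = Suc ` S" for S :: "nat set"
  define new where "new S = insert 0 (Suc ` S)" for S :: "nat set"
  define h where "h x = old (i x)" for x
  have "inj old" "inj new"
    by (auto simp: old_def new_def inj_def)
  have "old S \<noteq> new T" for S T
    by (auto simp: old_def new_def)
  obtain B where B: "nbhd_system B" "nbhd_system.nbhd_topology B = X"
    using nbhd_system_of_first_countable_regular[OF assms(3,4)] by blast
  have points: "points B = topspace X"
    using nbhd_system.topspace_nbhd_topology[OF B(1)] B(2) by simp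
  have h: "inj_on h (points B)"
    using i \<open>inj old\<close> unfolding h_def points inj_on_def inj_def by blast
  obtain B0 where B0: "nbhd_system B0" "points B0 = h ` points B"
    and hom: "homeomorphic_map X (nbhd_system.nbhd_topology B0) h"
    using nbhd_system_homeomorphic_copy[OF B(1) h] B(2) by blast
  have "small (points B0)"
    unfolding B0(2) points by (rule small_image[OF small])
  moreover have "range new \<inter> points B0 = {}"
    using \<open>\<And>S T. old S \<noteq> new T\<close> unfolding B0(2) h_def by fastforce
  ultimately obtain B1 where B1: "nbhd_system B1" and ext: "dense_extension B0 B1"
    and cc: "countably_compact_space (nbhd_system.nbhd_topology B1)"
    using countably_compact_dense_extension[OF assms(1,2) B0(1) _ \<open>inj new\<close>] by blast
  interpret B1: nbhd_system B1 by fact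
  have image: "h ` topspace X = points B0"
    by (simp add: B0(2) points)
  have "embedding_map X B1.nbhd_topology h"
    unfolding embedding_map_def image subtopology_dense_extension[OF B0(1) B1 ext] by (rule hom)
  moreover have "B1.nbhd_topology closure_of (h ` topspace X) = topspace B1.nbhd_topology"
    unfolding image B1.topspace_nbhd_topology by (rule closure_of_dense_extension[OF B1 ext])
  ultimately have "dense_embedding X B1.nbhd_topology h"
    by (simp add: dense_embedding_def)
  then show ?thesis
    using B1.first_countable_nbhd_topology cc B1.regular_T1_nbhd_topology by blast
qed

end
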